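(* For all $\psi_1,\psi_2\in\mathrm{MNF}$: if $\psi_1\equiv\psi_2$ in $\mathbf{TSC}$, then $\psi_1$ and $\psi_2$ are the same formula.
   Context: Ordinals range below $\varepsilon_0$. $\mathbb{F}_{\varepsilon_0}$ is the least set containing $\top$, closed under $\wedge$ and under unary modalities $\langle n^\alpha\rangle$ ($n<\omega$, $\alpha<\varepsilon_0$); $\langle n^0\rangle\varphi$ denotes $\varphi$. Hyper-exponentials: $e^0=\mathrm{id}$, $e^1(\alpha)=-1+\omega^\alpha$, $e^{n+m}=e^n\circ e^m$. MNF is the least set with: $\top\in$ MNF; each monomial $\langle n^\alpha\rangle\top\in$ MNF; if $\langle n_0^{\alpha_0}\rangle\top\wedge\cdots\wedge\langle n_k^{\alpha_k}\rangle\top\in$ MNF, $n<n_0$, and $\alpha=e^{n_0-n}(\alpha_0)\cdot(2+\beta)$ for some $\beta<\varepsilon_0$, then $\langle n^\alpha\rangle\top\wedge\langle n_0^{\alpha_0}\rangle\top\wedge\cdots\wedge\langle n_k^{\alpha_k}\rangle\top\in$ MNF. $\mathbf{TSC}$ derives sequents $\varphi\vdash\psi$; $\varphi\equiv\psi$ means both directions derivable. Axioms: $\varphi\vdash\varphi$; $\varphi\vdash\top$; $\varphi\wedge\psi\vdash\varphi$; $\varphi\wedge\psi\vdash\psi$; $\langle n^\alpha\rangle\varphi\vdash\langle n^\beta\rangle\varphi$ for $\beta\le\alpha$; $\langle n^{\alpha+\beta}\rangle\varphi\equiv\langle n^\beta\rangle\langle n^\alpha\rangle\varphi$; $\langle(m+n)^\alpha\rangle\varphi\vdash\langle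 m^{e^n(\alpha)}\rangle\varphi$; Schmerl axioms $\langle n^\alpha\rangle(\langle n_0^{\alpha_0}\rangle\top\wedge\cdots\wedge\langle n_k^{\alpha_k}\rangle\top)\equiv\langle n^{e^{n_0-n}(\alpha_0)\cdot(1+\alpha)}\rangle\top\wedge\langle n_0^{\alpha_0}\rangle\top\wedge\cdots\wedge\langle n_k^{\alpha_k}\rangle\top$ for $n<n_0$ and the conjunction in MNF. Rules: from $\varphi\vdash\psi$, $\varphi\vdash\chi$ infer $\varphi\vdash\psi\wedge\chi$; from $\varphi\vdash\psi$, $\psi\vdash\chi$ infer $\varphi\vdash\chi$; from $\varphi\vdash\psi$ infer $\langle n^\alpha\rangle\varphi\vdash\langle n^\alpha\rangle\psi$; from $\varphi\vdash\psi$ infer $\langle n^\alpha\rangle\varphi\wedge\langle m^{\beta+1}\rangle\psi\vdash\langle n^\alpha\rangle(\varphi\wedge\langle m^{\beta+1}\rangle\psi)$ for $m<n$.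
   Formalization: In the MNF clause and the Schmerl axioms the leading exponent α₀ of the given conjunction is required to be nonzero; with α₀=0 allowed, ⊤∧⊤ would be an MNF equivalent to but different from ⊤, and ⊤⊢⟨n^α⟩⊤ would be derivable. *)

theory Defs
  imports Main
begin

section \<open>Ordinals below epsilon-zero\<close>

text \<open>
  Ordinals below epsilon-zero are represented by Cantor normal forms:
  \<^term>\<open>CNil\<close> is 0 and \<open>CAdd a b\<close> is \<open>\<omega>\<^sup>a + b\<close>, where in a normal form the exponents
  are weakly decreasing.
\<close>

datatype cnf = CNil | CAdd cnf cnf

instantiation cnf :: linorder
begin

fun less_cnf :: "cnf \<Rightarrow> cnf \<Rightarrow> bool" where
  "less_cnf x CNil \<longleftrightarrow> False"
| "less_cnf CNil (CAdd c d) \<longleftrightarrow> True"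
| "less_cnf (CAdd a b) (CAdd c d) \<longleftrightarrow> a < c \<or> (a = c \<and> b < d)"

definition less_eq_cnf :: "cnf \<Rightarrow> cnf \<Rightarrow> bool" where
  "less_eq_cnf x y \<longleftrightarrow> x < y \<or> x = y"

instance
proof
  have irrefl: "\<not> x < x" for x :: cnf
    by (induction x) auto
  have trans: "x < y \<Longrightarrow> y < z \<Longrightarrow> x < z" for x y z :: cnf
  proof (induction x arbitrary: y z)
    case CNil
    then show ?case by (cases y; cases z) auto
  next
    case (CAdd x1 x2)
    then show ?case by (cases y; cases z) auto
  qed
  have total: "x < y \<or> x = y \<or> y < x" for x y :: cnf
  proof (induction x arbitrary: y)
    case CNil
    then show ?case by (cases y) auto
  next
    case (CAdd x1 x2)
    show ?case using CAdd.IH by (cases y) auto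
  qed
  fix x y z :: cnf
  show "(x < y) = (x \<le> y \<and> \<not> y \<le> x)"
    using irrefl trans by (auto simp: less_eq_cnf_def)
  show "x \<le> x" by (simp add: less_eq_cnf_def)
  show "x \<le> y \<Longrightarrow> y \<le> z \<Longrightarrow> x \<le> z" using trans by (auto simp: less_eq_cnf_def)
  show "x \<le> y \<Longrightarrow> y \<le> x \<Longrightarrow> x = y" using irrefl trans by (auto simp: less_eq_cnf_def)
  show "x \<le> y \<or> y \<le> x" using total by (auto simp: less_eq_cnf_def)
qed

end

fun nf :: "cnf \<Rightarrow> bool" where
  "nf CNil \<longleftrightarrow> True"
| "nf (CAdd a CNil) \<longleftrightarrow> nf a"
| "nf (CAdd a (CAdd c d)) \<longleftrightarrow> nf a \<and> nf (CAdd c d) \<and> c \<le> a"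

fun cadd :: "cnf \<Rightarrow> cnf \<Rightarrow> cnf" where
  "cadd CNil y = y"
| "cadd (CAdd a b) CNil = CAdd a b"
| "cadd (CAdd a b) (CAdd c d) = (if a < c then CAdd c d else CAdd a (cadd b (CAdd c d)))"

text \<open>\<open>\<alpha> \<cdot> \<omega>\<^sup>c\<close> is \<open>\<omega>\<^bsup>a+c\<^esup>\<close> for \<open>c > 0\<close>, where \<open>a\<close> is the leading exponent of \<open>\<alpha> > 0\<close>.\<close>

fun cmult :: "cnf \<Rightarrow> cnf \<Rightarrow> cnf" where
  "cmult CNil y = CNil"
| "cmult (CAdd a b) CNil = CNil"
| "cmult (CAdd a b) (CAdd c d) =
    (if c = CNil then cadd (CAdd a b) (cmult (CAdd a b) d)
     else CAdd (cadd a c) (cmult (CAdd a b) d))"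

lemma cnf_simps [simp]: "\<not> x < CNil" "CNil \<le> x" "x \<le> CNil \<longleftrightarrow> x = CNil"
    "CNil < x \<longleftrightarrow> x \<noteq> CNil"
    "CAdd a b \<le> CAdd c d \<longleftrightarrow> a < c \<or> (a = c \<and> b \<le> d)"
     apply (cases x; auto simp: less_eq_cnf_def)+
  done

lemma cadd_CNil [simp]: "cadd x CNil = x"
  by (cases x) auto

lemma nf_CAdd_iff: "nf (CAdd a b) \<longleftrightarrow> nf a \<and> nf b \<and> (\<forall>c d. b = CAdd c d \<longrightarrow> c \<le> a)"
  by (cases b) auto

lemma nf_tail_less: "nf (CAdd a b) \<Longrightarrow> b < CAdd a b"
  by (induction b arbitrary: a) (auto simp: nf_CAdd_iff order_le_less)

lemma nf_cadd: "nf x \<Longrightarrow> nf y \<Longrightarrow> nf (cadd x y)"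
proof (induction x y rule: cadd.induct)
  case (3 a b c d)
  then show ?case
    by (cases b) (auto simp: nf_CAdd_iff split: if_splits)
qed auto

lemma cadd_assoc: "cadd (cadd x y) z = cadd x (cadd y z)"
proof (induction x arbitrary: y z)
  case (CAdd a b)
  show ?case
    by (cases y; cases z) (auto simp: CAdd.IH)
qed auto

lemma cadd_less_mono: "y < z \<Longrightarrow> cadd x y < cadd x z"
proof (induction x arbitrary: y z)
  case (CAdd a b)
  from CAdd.prems CAdd.IH(2)[of y z] show ?case
    by (cases y; cases z) (auto split: if_splits)
qed auto

lemma cadd_diff: "nf x \<Longrightarrow> nf z \<Longrightarrow> x \<le> z \<Longrightarrow> \<exists>y. nf y \<and> z = cadd x y"
proof (induction x arbitrary: z)
  case (CAdd a b)
  from CAdd.prems obtain c d where z: "z = CAdd c d" by (cases z) auto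
  show ?case
  proof (cases "a < c")
    case True
    then show ?thesis using CAdd.prems z by (intro exI[of _ z]) auto
  next
    case False
    with CAdd.prems z have c: "c = a" "b \<le> d" "nf b" "nf d" by (auto simp: nf_CAdd_iff)
    from CAdd.IH(2)[OF c(3,4,2)] obtain y where y: "nf y" "d = cadd b y" by auto
    have "\<not> a < e" if "y = CAdd e f" for e f
      using CAdd.prems(2) z c y that by (cases b) (auto simp: nf_CAdd_iff split: if_splits)
    with y c z show ?thesis by (intro exI[of _ y]) (cases y; auto)
  qed
qed auto


lemma cmult_CNil [simp]: "cmult x CNil = CNil"
  by (cases x) auto

lemma cmult_lead:
  assumes "nf (CAdd e f)"
  shows "\<exists>g. cmult (CAdd a b) (CAdd e f) = CAdd (cadd a e) g"
  using assms
proof (induction f arbitrary: e)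
  case (CAdd f1 f2)
  show ?case
  proof (cases "e = CNil")
    case True
    with CAdd.prems have "f1 = CNil" "nf (CAdd f1 f2)" by (auto simp: nf_CAdd_iff)
    with CAdd.IH(2)[of f1] CAdd.prems have "\<exists>g. cmult (CAdd a b) (CAdd f1 f2) = CAdd a g"
      by (cases f2) (auto split: if_splits)
    with True show ?thesis by (auto simp del: cmult.simps(3) simp: cmult.simps(3)[of a b CNil])
  qed auto
qed auto

lemma cadd_less_self: "y \<noteq> CNil \<Longrightarrow> x < cadd x y"
  using cadd_less_mono[of CNil y x] by auto

lemma cadd_le_mono: "y \<le> z \<Longrightarrow> cadd x y \<le> cadd x z"
  using cadd_less_mono[of y z x] by (auto simp: less_eq_cnf_def)

lemma nf_cmult: "nf x \<Longrightarrow> nf y \<Longrightarrow> nf (cmult x y)"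
proof (induction x y rule: cmult.induct)
  case (3 a b c d)
  show ?case
  proof (cases "c = CNil")
    case True
    with 3 show ?thesis by (auto simp: nf_CAdd_iff nf_cadd)
  next
    case False
    have IH: "nf (cmult (CAdd a b) d)" "nf d" "nf a" "nf c"
      using 3 False by (auto simp: nf_CAdd_iff)
    have "k \<le> cadd a c" if "cmult (CAdd a b) d = CAdd k l" for k l
    proof (cases d)
      case (CAdd e f)
      with IH(2) cmult_lead[of e f a b] that have "k = cadd a e" by auto
      moreover have "e \<le> c" using 3(4) CAdd by auto
      ultimately show ?thesis by (simp add: cadd_le_mono)
    qed (use that in auto)
    with IH False show ?thesis by (auto simp: nf_CAdd_iff nf_cadd)
  qed
qed auto

lemma cmult_cadd_distrib:
  assumes "nf y" "nf z"
  shows "cmult x (cadd y z) = cadd (cmult x y) (cmult x z)"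
proof (cases x)
  case (CAdd a b)
  from assms show ?thesis
  proof (induction y)
    case (CAdd c d)
    have IH: "cmult x (cadd d z) = cadd (cmult x d) (cmult x z)"
      using CAdd by (auto simp: nf_CAdd_iff)
    show ?case
    proof (cases z)
      case z: (CAdd e f)
      obtain g where g: "cmult x z = CAdd (cadd a e) g"
        using cmult_lead[of e f a b] CAdd.prems(2) z \<open>x = CAdd a b\<close> by auto
      show ?thesis
      proof (cases "c < e")
        case True
        then have e: "e \<noteq> CNil" by auto
        have dz: "cadd d z = z"
          using CAdd.prems(1) True z by (cases d) auto
        have "a < cadd a e" using e by (rule cadd_less_self)
        then have xxz: "cadd x (cmult x z) = cmult x z"
          unfolding g by (simp add: \<open>x = CAdd a b\<close>)
        have yz: "cadd (CAdd c d) z = z" using True z by simp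
        have "cadd (cmult x (CAdd c d)) (cmult x z) = cmult x z"
        proof (cases "c = CNil")
          case True
          then have "cmult x (CAdd c d) = cadd x (cmult x d)" using \<open>x = CAdd a b\<close> by simp
          then show ?thesis by (simp only: cadd_assoc IH[symmetric] dz xxz)
        next
          case False
          then have "cmult x (CAdd c d) = CAdd (cadd a c) (cmult x d)" using \<open>x = CAdd a b\<close> by simp
          then show ?thesis unfolding g using cadd_less_mono[OF True, of a] by simp
        qed
        then show ?thesis unfolding yz by (rule sym)
      next
        case False
        then have "\<not> cadd a c < cadd a e" by (simp add: not_less cadd_le_mono)
        note le = this
        have yz: "cadd (CAdd c d) z = CAdd c (cadd d z)" using False z by simp
        show ?thesis
        proof (cases "c = CNil")
          case True
          then have "cmult x (CAdd c w) = cadd x (cmult x w)" for w using \<open>x = CAdd a b\<close> by simp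
          then show ?thesis by (simp only: yz cadd_assoc IH)
        next
          case False
          then have "cmult x (CAdd c w) = CAdd (cadd a c) (cmult x w)" for w
            using \<open>x = CAdd a b\<close> by simp
          moreover have "cadd (CAdd (cadd a c) w) (cmult x z) = CAdd (cadd a c) (cadd w (cmult x z))" for w
            unfolding g using le by simp
          ultimately show ?thesis by (simp only: yz IH)
        qed
      qed
    qed auto
  qed auto
qed auto

lemma nf_wf: "wf {(x, y). nf x \<and> nf y \<and> x < (y :: cnf)}" (is "wf ?R")
proof -
  have step: "CAdd a b \<in> Wellfounded.acc ?R"
    if "a \<in> Wellfounded.acc ?R" "b \<in> Wellfounded.acc ?R" "nf (CAdd a b)" for a b
    using that
  proof (induction a arbitrary: b rule: acc_induct_rule)
    case (1 a)
    note outer = 1(2)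
    from 1(3,4) show ?case
    proof (induction b rule: acc_induct_rule)
      case (1 b)
      note inner = 1(2) and nf = 1(3) and b = 1(1)
      have "y \<in> Wellfounded.acc ?R" if "nf y" "y < CAdd a b" for y
        using that
      proof (induction y)
        case CNil
        show ?case by (rule accI) auto
      next
        case (CAdd c d)
        have cd: "nf c" "nf d" "d < CAdd c d" "nf a" "nf b"
          using CAdd.prems(1) nf nf_tail_less by (auto simp: nf_CAdd_iff)
        have d: "d \<in> Wellfounded.acc ?R"
          using CAdd.IH(2) cd CAdd.prems(2) by (meson less_trans)
        from CAdd.prems(2) consider "c < a" | "c = a" "d < b" by auto
        then show ?case
        proof cases
          case 1
          then show ?thesis using outer[of c d] cd d CAdd.prems(1) by blast
        next
          case 2
          then show ?thesis using inner[of d] cd CAdd.prems(1) by blast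
        qed
      qed
      then show ?case by - (rule accI, blast)
    qed
  qed
  have nfacc: "x \<in> Wellfounded.acc ?R" if "nf x" for x
    using that
  proof (induction x)
    case CNil
    show ?case by (rule accI) auto
  next
    case (CAdd a b)
    then have "nf a" "nf b" by (auto simp: nf_CAdd_iff)
    with CAdd show ?case by (intro step) blast+
  qed
  moreover have "x \<in> Wellfounded.acc ?R" if "\<not> nf x" for x
    by (rule accI) (use that in auto)
  ultimately show ?thesis by (intro acc_wfI) blast
qed

typedef eps0 = "{x. nf x}"
  by (rule exI[of _ CNil]) simp

setup_lifting type_definition_eps0

instantiation eps0 :: "{zero, one, plus, times, linorder}"
begin

lift_definition zero_eps0 :: eps0 is CNil by simp
lift_definition one_eps0 :: eps0 is "CAdd CNil CNil" by simp
lift_definition plus_eps0 :: "eps0 \<Rightarrow> eps0 \<Rightarrow> eps0" is cadd by (rule nf_cadd)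
lift_definition times_eps0 :: "eps0 \<Rightarrow> eps0 \<Rightarrow> eps0" is cmult by (rule nf_cmult)
lift_definition less_eq_eps0 :: "eps0 \<Rightarrow> eps0 \<Rightarrow> bool" is "(\<le>)" .
lift_definition less_eps0 :: "eps0 \<Rightarrow> eps0 \<Rightarrow> bool" is "(<)" .

instance by standard (transfer; auto)+

end

instance eps0 :: wellorder
proof
  fix P :: "eps0 \<Rightarrow> bool" and a
  assume step: "\<And>x. (\<And>y. y < x \<Longrightarrow> P y) \<Longrightarrow> P x"
  have "wf {(x, y). x < (y :: eps0)}"
    by (rule wf_subset[OF wf_inv_image[OF nf_wf, of Rep_eps0]])
      (use Rep_eps0 in \<open>auto simp: inv_image_def less_eps0.rep_eq\<close>)
  then show "P a"
    by (induction a rule: wf_induct_rule) (use step in auto)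
qed

instance eps0 :: monoid_add
  by standard (transfer; simp add: cadd_assoc)+

instance eps0 :: zero_neq_one
  by standard (transfer; simp)

instance eps0 :: numeral ..

lift_definition omega_pow :: "eps0 \<Rightarrow> eps0" is "\<lambda>a. CAdd a CNil" by simp

text \<open>
  The next facts identify the structure: it is a well-order on which addition, multiplication and
  base-omega exponentiation satisfy the usual transfinite recursions, and which is exhausted by
  the towers of omega; hence its order type is epsilon-zero.
\<close>

lemma eps0_induct [case_names zero add]:
  assumes "P 0"
    and "\<And>a b. P a \<Longrightarrow> P b \<Longrightarrow> omega_pow a + b < omega_pow (a + 1) \<Longrightarrow> P (omega_pow a + b)"
  shows "P (x :: eps0)"
proof -
  have "P (Abs_eps0 c)" if "nf c" for c
    using that
  proof (induction c)
    case CNil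
    then show ?case using assms(1) by (simp add: zero_eps0_def)
  next
    case (CAdd a b)
    then have nf: "nf a" "nf b" by (auto simp: nf_CAdd_iff)
    have eq: "cadd (CAdd a CNil) b = CAdd a b"
      using CAdd.prems by (cases b) auto
    have sum: "omega_pow (Abs_eps0 a) + Abs_eps0 b = Abs_eps0 (CAdd a b)"
      using nf eq by (simp add: omega_pow.abs_eq plus_eps0.abs_eq eq_onp_def)
    have "omega_pow (Abs_eps0 a) + Abs_eps0 b < omega_pow (Abs_eps0 a + 1)"
      using nf CAdd.prems cadd_less_self[of "CAdd CNil CNil" a]
      by (simp add: one_eps0_def omega_pow.abs_eq plus_eps0.abs_eq less_eps0.abs_eq
          eq_onp_def nf_cadd eq)
    with assms(2)[of "Abs_eps0 a" "Abs_eps0 b"] CAdd.IH nf show ?case by (simp add: sum)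
  qed
  from this[of "Rep_eps0 x"] Rep_eps0[of x] show ?thesis by (simp add: Rep_eps0_inverse)
qed

lemma eps0_zero_le [simp]: "(0 :: eps0) \<le> x" "\<not> x < (0 :: eps0)" "0 < x \<longleftrightarrow> x \<noteq> (0 :: eps0)"
  by (transfer; simp)+

lemma eps0_add_less_mono: "y < z \<Longrightarrow> x + y < x + (z :: eps0)"
  by transfer (rule cadd_less_mono)

lemma eps0_add_le_mono: "y \<le> z \<Longrightarrow> x + y \<le> x + (z :: eps0)"
  by transfer (rule cadd_le_mono)

lemma eps0_add_less_cancel [simp]: "x + y < x + z \<longleftrightarrow> y < (z :: eps0)"
  using eps0_add_less_mono[of y z x] eps0_add_le_mono[of z y x] by (meson not_less)

lemma eps0_add_cancel [simp]: "x + y = x + z \<longleftrightarrow> y = (z :: eps0)"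
  by (metis eps0_add_less_cancel less_irrefl linorder_neqE)

lemma eps0_le_add1: "x \<le> x + (y :: eps0)"
  using eps0_add_le_mono[of 0 y x] by simp

lemma eps0_diff: "x \<le> z \<Longrightarrow> \<exists>y. z = x + (y :: eps0)"
  by transfer (use cadd_diff in blast)

lemma eps0_le_add2: "y \<le> x + (y :: eps0)"
proof (induction y rule: less_induct)
  case (less y)
  show ?case
  proof (rule ccontr)
    assume "\<not> y \<le> x + y"
    then have lt: "x + y < y" by simp
    with less have "x + y \<le> x + (x + y)" by blast
    moreover have "x + (x + y) < x + y" using lt by (rule eps0_add_less_mono)
    ultimately show False by (meson not_less)
  qed
qed

lemma eps0_add_le_mono1: "x \<le> y \<Longrightarrow> x + z \<le> y + (z :: eps0)"
proof -
  assume "x \<le> y"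
  then obtain w where "y = x + w" using eps0_diff by blast
  then show ?thesis using eps0_add_le_mono[OF eps0_le_add2[of z w], of x] by (simp add: add.assoc)
qed

lemma eps0_less_add1_iff: "x < y + 1 \<longleftrightarrow> x \<le> (y :: eps0)"
proof
  assume x: "x < y + 1"
  show "x \<le> y"
  proof (rule ccontr)
    assume "\<not> x \<le> y"
    then obtain z where z: "x = y + z" using eps0_diff[of y x] linear by blast
    with x have "z < 1" by simp
    then have "z = 0"
    proof (transfer, goal_cases)
      case (1 z)
      then show ?case by (cases z) auto
    qed
    with z \<open>\<not> x \<le> y\<close> show False by simp
  qed
next
  assume "x \<le> y"
  also have "y < y + 1" using eps0_add_less_mono[of 0 1 y] by simp
  finally show "x < y + 1" .
qed

lemma eps0_add1_le_iff: "x + 1 \<le> y \<longleftrightarrow> x < (y :: eps0)"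
  using eps0_less_add1_iff[of y x] by (meson not_less)

lemma eps0_mult_simps [simp]: "x * 0 = 0" "0 * x = 0" "x * 1 = x" "1 * x = (x :: eps0)"
proof -
  show "x * 0 = 0" "0 * x = 0" by (transfer; simp)+
  show "x * 1 = x" proof (transfer, goal_cases) case (1 x) then show ?case by (cases x) auto qed
  show "1 * x = x"
  proof (transfer, goal_cases)
    case (1 x)
    then show ?case
    proof (induction x)
      case (CAdd a b)
      then show ?case by (cases b) (auto simp: nf_CAdd_iff)
    qed auto
  qed
qed

lemma eps0_distrib: "x * (y + z) = x * y + x * (z :: eps0)"
  by transfer (rule cmult_cadd_distrib)

lemma eps0_mult_eq_0 [simp]: "x * y = 0 \<longleftrightarrow> x = 0 \<or> y = (0 :: eps0)"
proof (transfer, goal_cases)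
  case (1 x y)
  show ?case
  proof (cases "x = CNil \<or> y = CNil")
    case False
    then obtain a b c d where xy: "x = CAdd a b" "y = CAdd c d" by (metis cnf.exhaust)
    with 1 cmult_lead[of c d a b] show ?thesis by auto
  qed auto
qed

lemma eps0_mult_less_mono: "x \<noteq> 0 \<Longrightarrow> y < z \<Longrightarrow> x * y < x * (z :: eps0)"
proof -
  assume "x \<noteq> 0" "y < z"
  then obtain w where "z = y + w" using eps0_diff less_imp_le by blast
  moreover from this \<open>y < z\<close> have "w \<noteq> 0" by auto
  ultimately show ?thesis using \<open>x \<noteq> 0\<close> eps0_add_less_mono[of 0 "x * w" "x * y"] by (simp add: eps0_distrib)
qed

lemma eps0_mult_le_mono: "y \<le> z \<Longrightarrow> x * y \<le> x * (z :: eps0)"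
  using eps0_mult_less_mono[of x y z] by (cases "x = 0") (auto simp: le_less)

lemma omega_pow_0 [simp]: "omega_pow 0 = 1"
  by transfer simp

lemma omega_pow_neq_0 [simp]: "omega_pow a \<noteq> 0"
  by transfer simp

lemma omega_pow_less_iff [simp]: "omega_pow a < omega_pow b \<longleftrightarrow> a < b"
  by transfer simp

lemma omega_pow_le_iff [simp]: "omega_pow a \<le> omega_pow b \<longleftrightarrow> a \<le> b"
  using omega_pow_less_iff[of b a] by (meson not_less)

lemma omega_pow_add_closed: "x < omega_pow a \<Longrightarrow> y < omega_pow a \<Longrightarrow> x + y < omega_pow a"
proof (transfer, goal_cases)
  case (1 x a y)
  then show ?case by (cases x; cases y) auto
qed

lemma mult_omega_pow:
  assumes "omega_pow a \<le> x" "x < omega_pow (a + 1)" "d \<noteq> 0"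
  shows "x * omega_pow d = omega_pow (a + d)"
proof -
  have "b \<le> a" if "omega_pow b \<le> x" for b
  proof -
    from that assms(2) have "omega_pow b < omega_pow (a + 1)" by (rule le_less_trans)
    then show ?thesis by (simp add: eps0_less_add1_iff)
  qed
  with assms have "omega_pow a \<le> x" "\<forall>b. omega_pow b \<le> x \<longrightarrow> b \<le> a" "d \<noteq> 0" by auto
  then show ?thesis
  proof (transfer, goal_cases)
    case (1 a x d)
    from 1 obtain c b where x: "x = CAdd c b" by (cases x) auto
    have "c = a" using 1 x by (auto simp: nf_CAdd_iff)
    with 1 x show ?case by auto
  qed
qed

lemma omega_pow_leadE:
  assumes "x \<noteq> 0"
  obtains a where "omega_pow a \<le> x" "x < omega_pow (a + 1)"
proof -
  have "x \<noteq> 0 \<longrightarrow> (\<exists>a. omega_pow a \<le> x \<and> x < omega_pow (a + 1))"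
    by (induction x rule: eps0_induct) (use eps0_le_add1 in blast)+
  with assms that show ?thesis by blast
qed

theorem eps0_add_Least: "a + b = (LEAST c. a \<le> c \<and> (\<forall>b' < b. a + b' < (c :: eps0)))"
proof (rule Least_equality[symmetric])
  show "a \<le> a + b \<and> (\<forall>b' < b. a + b' < a + b)"
    by (simp add: eps0_le_add1)
next
  fix c assume c: "a \<le> c \<and> (\<forall>b' < b. a + b' < c)"
  then obtain d where "c = a + d" using eps0_diff by blast
  with c have "\<not> d < b" by auto
  with \<open>c = a + d\<close> show "a + b \<le> c" by (simp add: eps0_add_le_mono)
qed

theorem eps0_mult_Least: "a * b = (LEAST c. \<forall>b' < b. a * b' + a \<le> (c :: eps0))"
proof (cases "a = 0")
  case True
  have "(LEAST c. \<forall>b' < b. a * b' + a \<le> c) = 0"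
    by (rule Least_equality) (use True in auto)
  with True show ?thesis by simp
next
  case False
  obtain a0 where a0: "omega_pow a0 \<le> a" "a < omega_pow (a0 + 1)"
    using omega_pow_leadE[OF False] .
  have E: "\<exists>b < omega_pow d. c < a * b + a" if "c < omega_pow (a0 + d)" "d \<noteq> 0" for c d
    using that(1)
  proof (induction c rule: eps0_induct)
    case zero
    show ?case using False by (intro exI[of _ 0]) auto
  next
    case (add e c)
    show ?case
    proof (cases "omega_pow e + c < a")
      case True
      then show ?thesis by (intro exI[of _ 0]) auto
    next
      case ge: False
      have "\<not> e < a0"
      proof
        assume "e < a0"
        then have "omega_pow (e + 1) \<le> omega_pow a0" by (simp add: eps0_add1_le_iff)
        then have "omega_pow e + c < a" using add.hyps a0(1) by (meson less_le_trans)
        with ge show False by simp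
      qed
      then obtain e' where e': "e = a0 + e'" using eps0_diff[of a0 e] not_less by blast
      have "omega_pow e < omega_pow (a0 + d)"
        using add.prems eps0_le_add1[of "omega_pow e" c] by (rule le_less_trans[rotated])
      then have e'd: "e' < d" using e' by simp
      have "c < omega_pow (a0 + d)" using add.prems eps0_le_add2[of c "omega_pow e"]
        by (rule le_less_trans[rotated])
      with add.IH obtain b where b: "b < omega_pow d" "c < a * b + a" by auto
      have le: "omega_pow e \<le> a * omega_pow e'"
        using a0 e' mult_omega_pow[OF a0, of e'] by (cases "e' = 0") auto
      have "omega_pow e + c < omega_pow e + (a * b + a)" using b by simp
      also have "\<dots> \<le> a * omega_pow e' + (a * b + a)" using le by (rule eps0_add_le_mono1)
      also have "\<dots> = a * (omega_pow e' + b) + a" by (simp add: eps0_distrib add.assoc)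
      finally show ?thesis using b e'd
        by (intro exI[of _ "omega_pow e' + b"]) (auto intro: omega_pow_add_closed)
    qed
  qed
  have D: "\<exists>b' < b. c < a * b' + a" if "c < a * b" for b c
    using that
  proof (induction b arbitrary: c rule: eps0_induct)
    case (add d b)
    show ?case
    proof (cases "c < a * omega_pow d")
      case True
      have "\<exists>b' < omega_pow d. c < a * b' + a"
      proof (cases "d = 0")
        case True
        with \<open>c < a * omega_pow d\<close> show ?thesis by (intro exI[of _ 0]) auto
      next
        case False
        with True mult_omega_pow[OF a0 False] E show ?thesis by auto
      qed
      then show ?thesis using eps0_le_add1[of "omega_pow d" b] by (meson less_le_trans)
    next
      case False
      then obtain c' where c': "c = a * omega_pow d + c'"
        using eps0_diff[of "a * omega_pow d" c] not_less by blast
      with add.prems have "c' < a * b" by (simp add: eps0_distrib)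
      with add.IH obtain b' where "b' < b" "c' < a * b' + a" by blast
      then show ?thesis using c'
        by (intro exI[of _ "omega_pow d + b'"]) (auto simp: eps0_distrib add.assoc)
    qed
  qed auto
  show ?thesis
  proof (rule Least_equality[symmetric])
    have "a * b' + a \<le> a * b" if "b' < b" for b'
      using eps0_mult_le_mono[of "b' + 1" b a] that by (simp add: eps0_add1_le_iff eps0_distrib)
    then show "\<forall>b' < b. a * b' + a \<le> a * b" by blast
  next
    fix c assume "\<forall>b' < b. a * b' + a \<le> c"
    with D[of c b] show "a * b \<le> c" by (meson not_less)
  qed
qed

theorem omega_pow_Least:
  "omega_pow b = (LEAST c. 1 \<le> c \<and> (\<forall>b' < b. omega_pow b' * omega_pow 1 \<le> c))"
proof (rule Least_equality[symmetric])
  have mult: "omega_pow b' * omega_pow 1 = omega_pow (b' + 1)" for b'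
    by (rule mult_omega_pow) (auto simp: eps0_less_add1_iff)
  show "1 \<le> omega_pow b \<and> (\<forall>b' < b. omega_pow b' * omega_pow 1 \<le> omega_pow b)"
    using omega_pow_le_iff[of 0 b] by (auto simp: mult eps0_add1_le_iff)
  fix c assume c: "1 \<le> c \<and> (\<forall>b' < b. omega_pow b' * omega_pow 1 \<le> c)"
  show "omega_pow b \<le> c"
  proof (rule ccontr)
    assume "\<not> omega_pow b \<le> c"
    have "c \<noteq> 0" using c eps0_add1_le_iff[of 0 c] by auto
    then obtain e where e: "omega_pow e \<le> c" "c < omega_pow (e + 1)" using omega_pow_leadE by blast
    with \<open>\<not> omega_pow b \<le> c\<close> have "omega_pow e < omega_pow b"
      by (meson le_less_trans not_le)
    then have "omega_pow (e + 1) \<le> c" using c by (simp add: mult)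
    with e show False by simp
  qed
qed

theorem omega_pow_One_Least: "omega_pow 1 = (LEAST c. 0 < c \<and> (\<forall>b < c. b + 1 < c))"
proof (rule Least_equality[symmetric])
  have one: "(1 :: eps0) < omega_pow 1"
    using omega_pow_less_iff[of 0 1] by simp
  then show "0 < omega_pow 1 \<and> (\<forall>b < omega_pow 1. b + 1 < omega_pow 1)"
    by (auto intro: omega_pow_add_closed)
  fix c :: eps0 assume c: "0 < c \<and> (\<forall>b < c. b + 1 < c)"
  have "x < c" if "x < omega_pow 1" for x
    using that
  proof (induction x rule: less_induct)
    case (less x)
    show ?case
    proof (cases "x = 0")
      case False
      then have "\<exists>y. x = y + 1"
        using less.prems
      proof (transfer, goal_cases)
        case (1 x)
        then have "nf x" "x \<noteq> CNil" "x < CAdd (CAdd CNil CNil) CNil" by auto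
        then show ?case
        proof (induction x)
          case (CAdd a b)
          then have a: "a = CNil" by (cases a) auto
          show ?case
          proof (cases "b = CNil")
            case True
            then show ?thesis using a by (intro bexI[of _ CNil]) auto
          next
            case False
            have "nf b" "b < CAdd (CAdd CNil CNil) CNil"
              using CAdd.prems a by (cases b; auto simp: nf_CAdd_iff)+
            with CAdd.IH(2) False obtain y where y: "nf y" "b = cadd y (CAdd CNil CNil)" by auto
            have "nf (CAdd CNil y)" using CAdd.prems a y
              by (cases y) (auto simp: nf_CAdd_iff)
            then show ?thesis using a y by (intro bexI[of _ "CAdd CNil y"]) auto
          qed
        qed auto
      qed
      then obtain y where y: "x = y + 1" by blast
      then have "y < x" by (simp add: eps0_less_add1_iff)
      with less y c show ?thesis by auto
    qed (use c in auto)
  qed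
  then show "omega_pow 1 \<le> c" by (meson less_irrefl not_less)
qed

theorem omega_towers_cofinal: "\<exists>n. x < (omega_pow ^^ n) 0"
proof (induction x rule: eps0_induct)
  case zero
  show ?case by (intro exI[of _ 1]) auto
next
  case (add a b)
  then obtain n where "a < (omega_pow ^^ n) 0" by blast
  then have "omega_pow (a + 1) \<le> (omega_pow ^^ Suc n) 0" by (simp add: eps0_add1_le_iff)
  with add.hyps show ?case by (meson less_le_trans)
qed


section \<open>Hyper-exponentials\<close>

text \<open>\<open>lsub \<xi> \<zeta>\<close> is \<open>-\<xi> + \<zeta>\<close>, the unique \<open>\<eta>\<close> with \<open>\<xi> + \<eta> = \<zeta>\<close>, meaningful for \<open>\<xi> \<le> \<zeta>\<close>.\<close>

definition lsub :: "eps0 \<Rightarrow> eps0 \<Rightarrow> eps0" where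
  "lsub \<xi> \<zeta> = (THE \<eta>. \<xi> + \<eta> = \<zeta>)"

definition hexp :: "nat \<Rightarrow> eps0 \<Rightarrow> eps0" where
  "hexp n = (\<lambda>\<alpha>. lsub 1 (omega_pow \<alpha>)) ^^ n"

lemma lsub_add [simp]: "lsub \<xi> (\<xi> + \<eta>) = \<eta>"
  by (simp add: lsub_def)

lemma hexp_0: "hexp 0 = id"
  by (simp add: hexp_def id_def)

lemma hexp_add: "hexp (n + m) = hexp n \<circ> hexp m"
  by (simp add: hexp_def funpow_add)

lemma hexp_1: "hexp 1 \<alpha> = (if \<alpha> = 0 then 0 else omega_pow \<alpha>)"
proof (cases "\<alpha> = 0")
  case True
  then show ?thesis using lsub_add[of 1 0] by (simp add: hexp_def)
next
  case False
  then have "1 + omega_pow \<alpha> = omega_pow \<alpha>" by transfer auto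
  with False show ?thesis using lsub_add[of 1 "omega_pow \<alpha>"] by (simp add: hexp_def)
qed


section \<open>Formulas and monomial normal forms\<close>

datatype form = Top | Conj form form (infixr "\<^bold>\<and>" 65) | Mod nat eps0 form

text \<open>
  \<open>\<langle>n\<^sup>0\<rangle>\<phi>\<close> is merely another name for \<open>\<phi>\<close>, so modalities are written with \<open>dia\<close>, and \<open>Mod\<close> is
  applied to nonzero exponents only in the formulas of \<open>Form\<close>.
\<close>

definition dia :: "nat \<Rightarrow> eps0 \<Rightarrow> form \<Rightarrow> form" where
  "dia n \<alpha> \<phi> = (if \<alpha> = 0 then \<phi> else Mod n \<alpha> \<phi>)"

inductive_set Form :: "form set" where
  Top: "Top \<in> Form"
| Conj: "\<phi> \<in> Form \<Longrightarrow> \<psi> \<in> Form \<Longrightarrow> \<phi> \<^bold>\<and> \<psi> \<in> Form"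
| dia: "\<phi> \<in> Form \<Longrightarrow> dia n \<alpha> \<phi> \<in> Form"

text \<open>\<open>mconj [(n\<^sub>0, \<alpha>\<^sub>0), \<dots>, (n\<^sub>k, \<alpha>\<^sub>k)]\<close> is \<open>\<langle>n\<^sub>0\<^bsup>\<alpha>\<^sub>0\<^esup>\<rangle>\<top> \<and> \<dots> \<and> \<langle>n\<^sub>k\<^bsup>\<alpha>\<^sub>k\<^esup>\<rangle>\<top>\<close>.\<close>

fun mconj :: "(nat \<times> eps0) list \<Rightarrow> form" where
  "mconj [] = Top"
| "mconj [(n, \<alpha>)] = dia n \<alpha> Top"
| "mconj ((n, \<alpha>) # x # xs) = dia n \<alpha> Top \<^bold>\<and> mconj (x # xs)"

text \<open>
  The conjuncts of a conjunction of monomials are proper monomials, that is, their exponents are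
  nonzero. Without the condition \<open>0 < \<alpha>\<^sub>0\<close> (which propagates to the other exponents), \<open>\<top>\<close> could be
  read as \<open>\<langle>n\<^sub>0\<^sup>0\<rangle>\<top>\<close>: then \<open>\<top> \<and> \<top>\<close> would be a monomial normal form, and the Schmerl axioms would
  yield \<open>\<top> \<turnstile> \<langle>n\<^sup>\<alpha>\<rangle>\<top>\<close> for every \<open>\<alpha>\<close>.
\<close>

inductive_set MNF :: "form set" where
  Top: "Top \<in> MNF"
| monomial: "dia n \<alpha> Top \<in> MNF"
| step: "\<lbrakk>mconj ((n\<^sub>0, \<alpha>\<^sub>0) # xs) \<in> MNF; 0 < \<alpha>\<^sub>0; n < n\<^sub>0; \<alpha> = hexp (n\<^sub>0 - n) \<alpha>\<^sub>0 * (2 + \<beta>)\<rbrakk>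
    \<Longrightarrow> mconj ((n, \<alpha>) # (n\<^sub>0, \<alpha>\<^sub>0) # xs) \<in> MNF"


section \<open>The Turing-Schmerl calculus\<close>

inductive tsc :: "form \<Rightarrow> form \<Rightarrow> bool" (infix "\<turnstile>" 50) where
  refl: "\<phi> \<in> Form \<Longrightarrow> \<phi> \<turnstile> \<phi>"
| top: "\<phi> \<in> Form \<Longrightarrow> \<phi> \<turnstile> Top"
| conj1: "\<lbrakk>\<phi> \<in> Form; \<psi> \<in> Form\<rbrakk> \<Longrightarrow> \<phi> \<^bold>\<and> \<psi> \<turnstile> \<phi>"
| conj2: "\<lbrakk>\<phi> \<in> Form; \<psi> \<in> Form\<rbrakk> \<Longrightarrow> \<phi> \<^bold>\<and> \<psi> \<turnstile> \<psi>"
| mono: "\<lbrakk>\<phi> \<in> Form; \<beta> \<le> \<alpha>\<rbrakk> \<Longrightarrow> dia n \<alpha> \<phi> \<turnstile> dia n \<beta> \<phi>"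
| add1: "\<phi> \<in> Form \<Longrightarrow> dia n (\<alpha> + \<beta>) \<phi> \<turnstile> dia n \<beta> (dia n \<alpha> \<phi>)"
| add2: "\<phi> \<in> Form \<Longrightarrow> dia n \<beta> (dia n \<alpha> \<phi>) \<turnstile> dia n (\<alpha> + \<beta>) \<phi>"
| reduct: "\<phi> \<in> Form \<Longrightarrow> dia (m + n) \<alpha> \<phi> \<turnstile> dia m (hexp n \<alpha>) \<phi>"
| schmerl1: "\<lbrakk>mconj ((n\<^sub>0, \<alpha>\<^sub>0) # xs) \<in> MNF; 0 < \<alpha>\<^sub>0; n < n\<^sub>0\<rbrakk> \<Longrightarrow>
    dia n \<alpha> (mconj ((n\<^sub>0, \<alpha>\<^sub>0) # xs)) \<turnstile>
    mconj ((n, hexp (n\<^sub>0 - n) \<alpha>\<^sub>0 * (1 + \<alpha>)) # (n\<^sub>0, \<alpha>\<^sub>0) # xs)"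
| schmerl2: "\<lbrakk>mconj ((n\<^sub>0, \<alpha>\<^sub>0) # xs) \<in> MNF; 0 < \<alpha>\<^sub>0; n < n\<^sub>0\<rbrakk> \<Longrightarrow>
    mconj ((n, hexp (n\<^sub>0 - n) \<alpha>\<^sub>0 * (1 + \<alpha>)) # (n\<^sub>0, \<alpha>\<^sub>0) # xs) \<turnstile>
    dia n \<alpha> (mconj ((n\<^sub>0, \<alpha>\<^sub>0) # xs))"
| conjI: "\<lbrakk>\<phi> \<turnstile> \<psi>; \<phi> \<turnstile> \<chi>\<rbrakk> \<Longrightarrow> \<phi> \<turnstile> \<psi> \<^bold>\<and> \<chi>"
| cut: "\<lbrakk>\<phi> \<turnstile> \<psi>; \<psi> \<turnstile> \<chi>\<rbrakk> \<Longrightarrow> \<phi> \<turnstile> \<chi>"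
| nec: "\<phi> \<turnstile> \<psi> \<Longrightarrow> dia n \<alpha> \<phi> \<turnstile> dia n \<alpha> \<psi>"
| dist: "\<lbrakk>\<phi> \<turnstile> \<psi>; m < n\<rbrakk> \<Longrightarrow>
    dia n \<alpha> \<phi> \<^bold>\<and> dia m (\<beta> + 1) \<psi> \<turnstile> dia n \<alpha> (\<phi> \<^bold>\<and> dia m (\<beta> + 1) \<psi>)"

definition tsc_equiv :: "form \<Rightarrow> form \<Rightarrow> bool" (infix "\<equiv>\<^sub>T" 50) where
  "\<phi> \<equiv>\<^sub>T \<psi> \<longleftrightarrow> \<phi> \<turnstile> \<psi> \<and> \<psi> \<turnstile> \<phi>"

lemma mconj_Form: "mconj xs \<in> Form"
  by (induction xs rule: mconj.induct) (auto intro: Form.intros)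

lemma MNF_Form: "\<psi> \<in> MNF \<Longrightarrow> \<psi> \<in> Form"
  by (induction rule: MNF.induct) (auto intro: Form.intros mconj_Form)

lemma tsc_Form: "\<phi> \<turnstile> \<psi> \<Longrightarrow> \<phi> \<in> Form \<and> \<psi> \<in> Form"
  by (induction rule: tsc.induct) (auto intro: Form.intros mconj_Form)

end

(*
  Formulas are interpreted over Ignatiev sequences of ordinals: f (n + 1) is at most the last
  exponent of the Cantor normal form of f n. The formula <n^alpha> phi holds at g if g dominates
  pointwise the sequence obtained from some h satisfying phi by raising h n by
  omega^(h (n + 1)) * alpha and then, going down from i = n - 1, each h i by omega to the new
  value at i + 1. Each axiom of TSC then becomes an inequality between sequences; the distribution
  rule also needs that the sequences satisfying a formula are closed under pointwise minima.
  A monomial normal form holds precisely above one Ignatiev sequence, so equivalent normal forms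
  have the same sequence; its monomials are at the n where f n differs from e^1 (f (n + 1)), so the
  normal form can be read off.
*)
theory Submission
  imports Defs
begin

declare One_nat_def [simp del]

section \<open>Ordinal arithmetic\<close>

lemma eps0_le_0 [simp]: "x \<le> 0 \<longleftrightarrow> x = (0 :: eps0)"
  by transfer simp

lemma omega_pow_absorb: "x < omega_pow a \<Longrightarrow> x + omega_pow a = omega_pow a"
proof (transfer, goal_cases)
  case (1 x a)
  then show ?case by (cases x) auto
qed

text \<open>A product is a least upper bound over smaller right factors, so induction on
  \<open>z\<close> reduces the claim to comparing \<open>x * b + x\<close> with
  \<open>y * b + y\<close> for \<open>b < z\<close>.\<close>

lemma eps0_mult_le_mono1:
  assumes "x \<le> y"
  shows "x * z \<le> y * (z :: eps0)"
proof (induction z rule: less_induct)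
  case (less z)
  have "x * b + x \<le> y * z" if "b < z" for b
  proof -
    have "x * b + x \<le> y * b + x" using less that by (simp add: eps0_add_le_mono1)
    also have "\<dots> \<le> y * b + y" using assms by (rule eps0_add_le_mono)
    also have "\<dots> = y * (b + 1)" by (simp add: eps0_distrib)
    also have "\<dots> \<le> y * z" using that by (simp add: eps0_mult_le_mono eps0_add1_le_iff)
    finally show ?thesis .
  qed
  then show ?case unfolding eps0_mult_Least[of x z] by (intro Least_le) blast
qed

lemma eps0_add_mono: "x \<le> x' \<Longrightarrow> y \<le> y' \<Longrightarrow> x + y \<le> x' + (y' :: eps0)"
  using eps0_add_le_mono eps0_add_le_mono1 order_trans by blast

lemma eps0_mult_mono: "x \<le> x' \<Longrightarrow> y \<le> y' \<Longrightarrow> x * y \<le> x' * (y' :: eps0)"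
  using eps0_mult_le_mono eps0_mult_le_mono1 order_trans by blast

lemma eps0_less_add: "y \<noteq> 0 \<Longrightarrow> x < x + (y :: eps0)"
  using eps0_add_less_mono[of 0 y x] by simp

lemma eps0_add_eq_0 [simp]: "x + y = 0 \<longleftrightarrow> x = 0 \<and> y = (0 :: eps0)"
  using eps0_le_add1[of x y] eps0_le_add2[of y x] by (auto simp: antisym)

lemma eps0_one_le: "x \<noteq> 0 \<Longrightarrow> (1 :: eps0) \<le> x"
  using eps0_add1_le_iff[of 0 x] by simp

lemma eps0_one_le_omega_pow: "1 \<le> omega_pow a"
  by (rule eps0_one_le) simp

lemma eps0_two_add: "2 + \<beta> = 1 + (1 + \<beta> :: eps0)"
  by (metis add.assoc one_add_one)

lemma omega_pow_mult: "omega_pow a * omega_pow b = omega_pow (a + b)"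
  by (cases "b = 0") (auto intro: mult_omega_pow simp: eps0_less_add1_iff)

lemma omega_pow_mult_assoc: "omega_pow a * (omega_pow b * x) = omega_pow (a + b) * x"
  by (induction x rule: eps0_induct) (auto simp: eps0_distrib omega_pow_mult add.assoc)

section \<open>Left divisibility by powers of omega\<close>

instance eps0 :: Rings.dvd ..

text \<open>Here \<open>dvd\<close> speaks of left factors: for nonzero \<open>x\<close>,
  \<open>omega_pow b dvd x\<close> means that the last exponent of the Cantor normal form of
  \<open>x\<close> is at least \<open>b\<close>.\<close>

lemma omega_pow_dvd_mono:
  assumes "omega_pow b dvd x" "a \<le> b"
  shows "omega_pow a dvd x"
  using assms eps0_diff[OF assms(2)] by (auto simp: dvd_def omega_pow_mult_assoc[symmetric])

text \<open>The Cantor normal form is cut at exponent \<open>a\<close>: terms with exponent at least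
  \<open>a\<close> make up the multiple, the others the remainder.\<close>

lemma omega_pow_division: "\<exists>d r. x = omega_pow a * d + r \<and> r < omega_pow a"
proof (induction x rule: eps0_induct)
  case zero
  show ?case by (intro exI[of _ 0]) auto
next
  case (add c b)
  show ?case
  proof (cases "a \<le> c")
    case True
    then obtain e where e: "c = a + e" using eps0_diff by blast
    from add.IH obtain d r where "b = omega_pow a * d + r" "r < omega_pow a" by blast
    then have "omega_pow c + b = omega_pow a * (omega_pow e + d) + r \<and> r < omega_pow a"
      by (simp add: e eps0_distrib omega_pow_mult add.assoc)
    then show ?thesis by blast
  next
    case False
    then have "omega_pow (c + 1) \<le> omega_pow a" by (simp add: eps0_add1_le_iff)
    with add.hyps have "omega_pow c + b < omega_pow a" by (rule less_le_trans)
    then show ?thesis by (intro exI[of _ 0] exI[of _ "omega_pow c + b"]) auto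
  qed
qed

text \<open>The remainder of \<open>x\<close> is absorbed by the added power, so the sum is the
  least multiple of \<open>omega_pow a\<close> strictly above \<open>x\<close>.\<close>

lemma add_omega_pow_eq_mult: "\<exists>d. x + omega_pow a = omega_pow a * (d + 1) \<and> omega_pow a * d \<le> x"
proof -
  obtain d r where x: "x = omega_pow a * d + r" and r: "r < omega_pow a"
    using omega_pow_division by blast
  show ?thesis
    by (intro exI[of _ d])
      (simp add: x add.assoc omega_pow_absorb[OF r] eps0_distrib eps0_le_add1)
qed

lemma omega_pow_dvd_add_self: "omega_pow a dvd x + omega_pow a"
  using add_omega_pow_eq_mult[of x a] by (auto simp: dvd_def)

lemma add_omega_pow_le:
  assumes "omega_pow a dvd c" "x < c"
  shows "x + omega_pow a \<le> c"
proof -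
  obtain e where e: "c = omega_pow a * e" using assms(1) by (auto simp: dvd_def)
  obtain d where d: "x + omega_pow a = omega_pow a * (d + 1)" "omega_pow a * d \<le> x"
    using add_omega_pow_eq_mult by blast
  have "d < e"
  proof (rule ccontr)
    assume "\<not> d < e"
    then have "c \<le> omega_pow a * d" by (simp add: e eps0_mult_le_mono)
    with d(2) assms(2) show False by simp
  qed
  then show ?thesis by (simp add: d(1) e eps0_mult_le_mono eps0_add1_le_iff)
qed

lemma add_omega_pow_less:
  assumes "omega_pow a dvd c" "x < c" "b < a"
  shows "x + omega_pow b < c"
proof -
  have "x + omega_pow b < x + omega_pow a" using assms(3) by simp
  also have "\<dots> \<le> c" using assms by (intro add_omega_pow_le)
  finally show ?thesis .
qed

section \<open>Unfolding hyper-exponentials one step at a time\<close>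

lemma hexp_0' [simp]: "hexp 0 \<alpha> = \<alpha>"
  by (simp add: hexp_0)

lemma hexp_Suc: "hexp (Suc k) \<alpha> = hexp 1 (hexp k \<alpha>)"
  using hexp_add[of 1 k] by (simp add: fun_eq_iff One_nat_def)

lemma hexp_eq_0 [simp]: "hexp k \<alpha> = 0 \<longleftrightarrow> \<alpha> = 0"
proof (induction k)
  case (Suc k)
  then show ?case by (simp add: hexp_Suc[of k] hexp_1)
qed simp

lemma hexp_diff_Suc: "i < n \<Longrightarrow> hexp (n - i) \<alpha> = hexp 1 (hexp (n - Suc i) \<alpha>)"
  using hexp_Suc[of "n - Suc i" \<alpha>] by (simp add: Suc_diff_Suc)


section \<open>Ignatiev sequences\<close>

text \<open>The last clause excludes \<open>a = 0\<close>, which every power of \<open>\<omega>\<close> divides.\<close>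

definition ign_step :: "eps0 \<Rightarrow> eps0 \<Rightarrow> bool" where
  "ign_step b a \<longleftrightarrow> omega_pow b dvd a \<and> (b \<noteq> 0 \<longrightarrow> a \<noteq> 0)"

definition ignatiev :: "(nat \<Rightarrow> eps0) \<Rightarrow> bool" where
  "ignatiev f \<longleftrightarrow> (\<forall>n. ign_step (f (Suc n)) (f n))"

lemma ign_step_0 [simp]: "ign_step 0 a"
  by (auto simp: ign_step_def dvd_def)

lemma ign_step_mono: "ign_step b a \<Longrightarrow> b' \<le> b \<Longrightarrow> ign_step b' a"
  using omega_pow_dvd_mono by (auto simp: ign_step_def)

lemma ign_step_add_omega_pow: "ign_step b (a + omega_pow b)"
  by (simp add: ign_step_def omega_pow_dvd_add_self)

lemma ign_step_hexp_le: "ign_step b a \<Longrightarrow> hexp 1 b \<le> a"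
  using add_omega_pow_le[of b a 0] by (auto simp: ign_step_def hexp_1)

lemma hexp_1_mono: "a \<le> b \<Longrightarrow> hexp 1 a \<le> hexp 1 b"
  by (auto simp: hexp_1)

lemma ignatiev_0: "ignatiev (\<lambda>_. 0)"
  by (simp add: ignatiev_def)

lemma ignatiev_dvd: "ignatiev f \<Longrightarrow> omega_pow (f (Suc n)) dvd f n"
  by (simp add: ignatiev_def ign_step_def)

text \<open>The smaller of \<open>f n\<close> and \<open>g n\<close> satisfies the condition with
  its own successor entry, and lowering that entry to the minimum only weakens the
  condition.\<close>

lemma ignatiev_min:
  assumes "ignatiev f" "ignatiev g"
  shows "ignatiev (\<lambda>i. min (f i) (g i))"
  unfolding ignatiev_def
proof
  fix n
  have "ign_step (f (Suc n)) (f n)" "ign_step (g (Suc n)) (g n)"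
    using assms by (auto simp: ignatiev_def)
  then show "ign_step (min (f (Suc n)) (g (Suc n))) (min (f n) (g n))"
    by (auto simp: min_def[of "f n"] elim!: ign_step_mono)
qed

lemma ignatiev_hexp_le:
  assumes "ignatiev g" "\<alpha> \<le> g (i + k)"
  shows "hexp k \<alpha> \<le> g i"
  using assms(2)
proof (induction k arbitrary: i)
  case (Suc k)
  then have "hexp k \<alpha> \<le> g (Suc i)" by simp
  then have "hexp 1 (hexp k \<alpha>) \<le> hexp 1 (g (Suc i))" by (rule hexp_1_mono)
  also have "\<dots> \<le> g i" using assms(1) by (simp add: ignatiev_def ign_step_hexp_le)
  finally show ?case by (simp add: hexp_Suc[of k])
qed simp

text \<open>Adding \<open>omega_pow x\<close> to \<open>f n\<close> gives the least multiple of
  \<open>omega_pow x\<close> strictly above \<open>f n\<close>. Thus the entries below the changed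
  position move up strictly, but no further than this and the Ignatiev condition require.\<close>

primrec fill :: "(nat \<Rightarrow> eps0) \<Rightarrow> nat \<Rightarrow> eps0 \<Rightarrow> nat \<Rightarrow> eps0" where
  "fill f 0 x = f(0 := x)"
| "fill f (Suc n) x = fill (f(Suc n := x)) n (f n + omega_pow x)"

lemma fill_above: "n < i \<Longrightarrow> fill f n x i = f i"
  by (induction n arbitrary: f x) auto

lemma fill_at [simp]: "fill f n x n = x"
  by (cases n) (auto simp: fill_above)

lemma fill_upd_above: "n < i \<Longrightarrow> (fill f n x)(i := y) = fill (f(i := y)) n x"
proof (induction n arbitrary: f x)
  case (Suc n)
  then have "(fill f (Suc n) x)(i := y) = fill (f(Suc n := x, i := y)) n (f n + omega_pow x)"
    unfolding fill.simps by (intro Suc.IH) simp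
  also have "f(Suc n := x, i := y) = f(i := y, Suc n := x)"
    using Suc.prems by (intro fun_upd_twist) simp
  finally have "(fill f (Suc n) x)(i := y) = fill (f(i := y, Suc n := x)) n (f n + omega_pow x)" .
  then show ?case using Suc.prems by (simp only: fill.simps) simp
qed (auto simp: fun_upd_twist)

lemma fill_mono: "f \<le> f' \<Longrightarrow> x \<le> x' \<Longrightarrow> fill f n x \<le> fill f' n x'"
proof (induction n arbitrary: f f' x x')
  case (Suc n)
  have "f(Suc n := x) \<le> f'(Suc n := x')" "f n + omega_pow x \<le> f' n + omega_pow x'"
    using Suc.prems by (auto simp: le_fun_def intro!: eps0_add_mono)
  then show ?case unfolding fill.simps by (rule Suc.IH)
qed (auto simp: le_fun_def)

lemma le_fill: "f n \<le> x \<Longrightarrow> f \<le> fill f n x"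
proof (induction n arbitrary: f x)
  case (Suc n)
  have "f \<le> f(Suc n := x)" using Suc.prems by (auto simp: le_fun_def)
  also have "\<dots> \<le> fill (f(Suc n := x)) n (f n + omega_pow x)"
    by (rule Suc.IH) (simp add: eps0_le_add1)
  finally show ?case by simp
qed (auto simp: le_fun_def)

lemma less_fill: "f n < x \<Longrightarrow> i \<le> n \<Longrightarrow> f i < fill f n x i"
proof (induction n arbitrary: f x)
  case (Suc n)
  show ?case
  proof (cases "i = Suc n")
    case False
    then have "(f(Suc n := x)) i < fill (f(Suc n := x)) n (f n + omega_pow x) i"
      using Suc.prems by (intro Suc.IH) (auto simp: eps0_less_add)
    then show ?thesis using False by simp
  qed (use Suc.prems in \<open>simp add: fill_above\<close>)
qed auto

text \<open>Minimality of the repair: strictness below \<open>n\<close> leaves room in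
  \<open>g\<close> for the next multiple at every position.\<close>

lemma fill_le:
  assumes "ignatiev g"
  shows "(\<And>i. n < i \<Longrightarrow> f i \<le> g i) \<Longrightarrow> x \<le> g n \<Longrightarrow> (\<And>i. i < n \<Longrightarrow> f i < g i) \<Longrightarrow> fill f n x \<le> g"
proof (induction n arbitrary: f x)
  case 0
  then show ?case by (auto simp: le_fun_def)
next
  case (Suc n)
  have "f n + omega_pow x \<le> f n + omega_pow (g (Suc n))"
    using Suc.prems by (simp add: eps0_add_le_mono)
  also have "\<dots> \<le> g n" using Suc.prems ignatiev_dvd[OF assms] by (intro add_omega_pow_le) auto
  finally have "f n + omega_pow x \<le> g n" .
  then show ?case using Suc.prems by (auto intro!: Suc.IH)
qed

text \<open>A power with exponent below \<open>g n\<close> is properly smaller than the power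
  dividing the preceding entry of \<open>g\<close>, so strictness passes downward.\<close>

lemma fill_less:
  assumes "ignatiev g"
  shows "x < g n \<Longrightarrow> (\<And>i. i < n \<Longrightarrow> f i < g i) \<Longrightarrow> i \<le> n \<Longrightarrow> fill f n x i < g i"
proof (induction n arbitrary: f x)
  case (Suc n)
  show ?case
  proof (cases "i = Suc n")
    case False
    have "f n + omega_pow x < g n"
      using Suc.prems ignatiev_dvd[OF assms] by (intro add_omega_pow_less) auto
    then show ?thesis using Suc.prems False by (auto intro!: Suc.IH)
  qed (use Suc.prems in \<open>simp add: fill_above\<close>)
qed auto

lemma fill_ignatiev:
  "(\<And>i. n < i \<Longrightarrow> ign_step (f (Suc i)) (f i)) \<Longrightarrow> ign_step (f (Suc n)) x \<Longrightarrow> ignatiev (fill f n x)"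
proof (induction n arbitrary: f x)
  case 0
  then show ?case by (auto simp: ignatiev_def)
next
  case (Suc n)
  have "ignatiev (fill (f(Suc n := x)) n (f n + omega_pow x))"
  proof (rule Suc.IH)
    show "ign_step ((f(Suc n := x)) (Suc i)) ((f(Suc n := x)) i)" if "n < i" for i
      using Suc.prems that by (cases "i = Suc n") auto
  qed (simp add: ign_step_add_omega_pow)
  then show ?case by simp
qed

text \<open>A later, larger raise erases the earlier one, because
  \<open>omega_pow x + omega_pow y = omega_pow y\<close> for \<open>x < y\<close>.\<close>

lemma fill_fill: "x < y \<Longrightarrow> fill (fill f n x) n y = fill f n y"
proof (induction n arbitrary: f x y)
  case (Suc n)
  have "omega_pow x + omega_pow y = omega_pow y" using Suc.prems by (simp add: omega_pow_absorb)
  moreover have "fill (fill (f(Suc n := y)) n (f n + omega_pow x)) n (f n + omega_pow y) =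
      fill (f(Suc n := y)) n (f n + omega_pow y)"
    using Suc.prems by (intro Suc.IH) simp
  ultimately show ?case by (simp add: fill_upd_above add.assoc)
qed auto

text \<open>The least Ignatiev sequence above \<open>f\<close> at which \<open>\<langle>n\<^sup>\<alpha>\<rangle>\<phi>\<close> holds when \<open>\<phi>\<close> holds at \<open>f\<close>.\<close>

definition progress :: "nat \<Rightarrow> eps0 \<Rightarrow> (nat \<Rightarrow> eps0) \<Rightarrow> nat \<Rightarrow> eps0" where
  "progress n \<alpha> f = (if \<alpha> = 0 then f else fill f n (f n + omega_pow (f (Suc n)) * \<alpha>))"

lemma progress_0 [simp]: "progress n 0 f = f"
  by (simp add: progress_def)

lemma progress_at: "progress n \<alpha> f n = f n + omega_pow (f (Suc n)) * \<alpha>"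
  by (simp add: progress_def)

lemma le_progress: "f \<le> progress n \<alpha> f"
  by (simp add: progress_def le_fill eps0_le_add1)

lemma less_progress: "\<alpha> \<noteq> 0 \<Longrightarrow> i \<le> n \<Longrightarrow> f i < progress n \<alpha> f i"
  by (simp add: progress_def less_fill eps0_less_add)

lemma progress_mono:
  assumes "f \<le> f'" "\<alpha> \<le> \<alpha>'"
  shows "progress n \<alpha> f \<le> progress n \<alpha>' f'"
proof (cases "\<alpha> = 0")
  case True
  then show ?thesis using assms le_progress[of f' n \<alpha>'] by (simp add: order_trans)
next
  case False
  with assms have "\<alpha>' \<noteq> 0" by auto
  with False assms show ?thesis
    by (auto simp: progress_def le_fun_def[of f f'] intro!: fill_mono eps0_add_mono eps0_mult_mono)
qed

lemma progress_ignatiev: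
  assumes "ignatiev f"
  shows "ignatiev (progress n \<alpha> f)"
proof (cases "\<alpha> = 0")
  case False
  have "ign_step (f (Suc n)) (f n + omega_pow (f (Suc n)) * \<alpha>)"
    using False ignatiev_dvd[OF assms, of n] by (auto simp: ign_step_def dvd_def eps0_distrib[symmetric])
  then show ?thesis using assms False by (auto simp: progress_def ignatiev_def[of f] intro: fill_ignatiev)
qed (use assms in simp)

text \<open>The first raise leaves entry \<open>Suc n\<close> alone, so both use the same multiplier
  and distributivity adds the exponents; \<open>fill_fill\<close> takes care of the entries
  below.\<close>

lemma progress_add: "progress n \<beta> (progress n \<alpha> f) = progress n (\<alpha> + \<beta>) f"
proof (cases "\<alpha> = 0 \<or> \<beta> = 0")
  case False
  have "omega_pow (f (Suc n)) * \<alpha> < omega_pow (f (Suc n)) * (\<alpha> + \<beta>)"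
    using False by (simp add: eps0_mult_less_mono eps0_less_add)
  then show ?thesis
    using False by (simp add: progress_def fill_above fill_fill add.assoc eps0_distrib[symmetric])
qed auto

text \<open>Raising entry \<open>Suc m\<close> by at least \<alpha> pushes entry \<open>m\<close> up
  by at least \<open>omega_pow (f (Suc m) + \<alpha>)\<close>, which is
  \<open>omega_pow (f (Suc m)) * omega_pow \<alpha>\<close>.\<close>

lemma progress_hexp_1_le: "progress m (hexp 1 \<alpha>) f \<le> progress (Suc m) \<alpha> f"
proof (cases "\<alpha> = 0")
  case False
  define y where "y = f (Suc m) + omega_pow (f (Suc (Suc m))) * \<alpha>"
  have "f (Suc m) + \<alpha> \<le> y"
    unfolding y_def using eps0_mult_mono[OF eps0_one_le_omega_pow order_refl, of \<alpha>]
    by (intro eps0_add_le_mono) simp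
  then have "f m + omega_pow (f (Suc m)) * hexp 1 \<alpha> \<le> f m + omega_pow y"
    using False by (simp add: hexp_1 omega_pow_mult eps0_add_le_mono)
  moreover have "f \<le> f(Suc m := y)" by (auto simp: le_fun_def y_def eps0_le_add1)
  ultimately have "fill f m (f m + omega_pow (f (Suc m)) * hexp 1 \<alpha>) \<le> fill f (Suc m) y"
    by (simp add: fill_mono)
  then show ?thesis using False by (simp add: progress_def y_def)
qed (simp add: hexp_1)

lemma progress_hexp_le: "progress m (hexp n \<alpha>) f \<le> progress (m + n) \<alpha> f"
proof (induction n arbitrary: m)
  case (Suc n)
  have "progress m (hexp (Suc n) \<alpha>) f \<le> progress (Suc m) (hexp n \<alpha>) f"
    unfolding hexp_Suc[of n] by (rule progress_hexp_1_le)
  also have "\<dots> \<le> progress (Suc m + n) \<alpha> f" by (rule Suc.IH)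
  finally show ?case by simp
qed simp


section \<open>Semantics\<close>

primrec sat :: "(nat \<Rightarrow> eps0) \<Rightarrow> form \<Rightarrow> bool" where
  "sat g Top \<longleftrightarrow> True"
| "sat g (\<phi> \<^bold>\<and> \<psi>) \<longleftrightarrow> sat g \<phi> \<and> sat g \<psi>"
| "sat g (Mod n \<alpha> \<phi>) \<longleftrightarrow> (\<exists>h. ignatiev h \<and> sat h \<phi> \<and> progress n \<alpha> h \<le> g)"

lemma sat_mono: "sat f \<phi> \<Longrightarrow> f \<le> g \<Longrightarrow> sat g \<phi>"
proof (induction \<phi>)
  case (Mod n \<alpha> \<phi>)
  then show ?case by (auto intro: order_trans)
qed auto

text \<open>Exponent 0 fits the same clause: \<open>progress n 0\<close> is the identity, and an
  Ignatiev \<open>g\<close> is its own witness.\<close>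

lemma sat_dia:
  "ignatiev g \<Longrightarrow> sat g (dia n \<alpha> \<phi>) \<longleftrightarrow> (\<exists>h. ignatiev h \<and> sat h \<phi> \<and> progress n \<alpha> h \<le> g)"
  using sat_mono by (auto simp: dia_def)

lemma sat_min: "sat f \<phi> \<Longrightarrow> sat g \<phi> \<Longrightarrow> sat (\<lambda>i. min (f i) (g i)) \<phi>"
proof (induction \<phi> arbitrary: f g)
  case (Mod n \<alpha> \<phi>)
  then obtain h k where h: "ignatiev h" "sat h \<phi>" "progress n \<alpha> h \<le> f"
    and k: "ignatiev k" "sat k \<phi>" "progress n \<alpha> k \<le> g" by auto
  let ?q = "\<lambda>i. min (h i) (k i)"
  have "progress n \<alpha> ?q \<le> f" "progress n \<alpha> ?q \<le> g"
    using h k progress_mono[of ?q h \<alpha> \<alpha> n] progress_mono[of ?q k \<alpha> \<alpha> n]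
    by (auto simp: le_fun_def intro: order_trans)
  then have "progress n \<alpha> ?q \<le> (\<lambda>i. min (f i) (g i))" by (auto simp: le_fun_def)
  moreover have "ignatiev ?q" "sat ?q \<phi>" using h k Mod.IH ignatiev_min by auto
  ultimately show ?case by auto
qed auto

lemma sat_dia_Top:
  assumes "ignatiev g"
  shows "sat g (dia n \<alpha> Top) \<longleftrightarrow> \<alpha> \<le> g n"
proof
  assume "sat g (dia n \<alpha> Top)"
  then obtain h where h: "progress n \<alpha> h \<le> g" using sat_dia[OF assms] by auto
  have "\<alpha> \<le> omega_pow (h (Suc n)) * \<alpha>"
    using eps0_mult_mono[OF eps0_one_le_omega_pow order_refl, of \<alpha>] by simp
  also have "\<dots> \<le> progress n \<alpha> h n" by (simp add: progress_at eps0_le_add2)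
  also have "\<dots> \<le> g n" using h by (simp add: le_fun_def)
  finally show "\<alpha> \<le> g n" .
next
  assume le: "\<alpha> \<le> g n"
  show "sat g (dia n \<alpha> Top)"
  proof (cases "\<alpha> = 0")
    case False
    \<comment> \<open>The witness is the zero sequence; these inequalities supply the strictness
      that \<open>fill_le\<close> asks for.\<close>
    have "g i \<noteq> 0" if "i < n" for i
      using ignatiev_hexp_le[OF assms, of \<alpha> i "n - i"] False le that
      by (metis add_diff_inverse_nat eps0_zero_le(1) hexp_eq_0 antisym less_imp_not_less)
    then have "fill (\<lambda>_. 0) n \<alpha> \<le> g" using le by (intro fill_le assms) auto
    then show ?thesis using sat_dia[OF assms] ignatiev_0 False
      by (auto simp: progress_def intro!: exI[of _ "\<lambda>_. 0"])
  qed (simp add: dia_def)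
qed

lemma sat_mconj:
  assumes "ignatiev g"
  shows "sat g (mconj xs) \<longleftrightarrow> (\<forall>(n, \<alpha>) \<in> set xs. \<alpha> \<le> g n)"
  by (induction xs rule: mconj.induct) (auto simp: sat_dia_Top[OF assms])

text \<open>The witness \<open>h\<close> for the outer modality is enlarged at entry
  \<open>m\<close> and below until it also satisfies the second conjunct. Since
  \<open>m < n\<close>, this does not alter the raise at \<open>n\<close>, provided the enlarged
  entries stay strictly below \<open>g\<close>.\<close>

lemma sat_dist:
  assumes g: "ignatiev g" and "m < n"
    and entails: "\<And>g. ignatiev g \<Longrightarrow> sat g \<phi> \<Longrightarrow> sat g \<psi>"
    and sat1: "sat g (dia n \<alpha> \<phi>)" and sat2: "sat g (dia m (\<beta> + 1) \<psi>)"
  shows "sat g (dia n \<alpha> (\<phi> \<^bold>\<and> dia m (\<beta> + 1) \<psi>))"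
proof (cases "\<alpha> = 0")
  case True
  then show ?thesis using sat1 sat2 by (simp add: dia_def)
next
  case False
  obtain h where h: "ignatiev h" "sat h \<phi>" "progress n \<alpha> h \<le> g" using sat1 sat_dia[OF g] by blast
  obtain h' where h': "ignatiev h'" "sat h' \<psi>" "progress m (\<beta> + 1) h' \<le> g"
    using sat2 sat_dia[OF g] by blast
  \<comment> \<open>Passing to the meet with \<open>h\<close> makes the witness for \<open>\<psi>\<close> lie below \<open>h\<close>.\<close>
  define f where "f = (\<lambda>i. min (h i) (h' i))"
  have f: "ignatiev f" "sat f \<psi>" using h h' entails by (auto simp: f_def ignatiev_min sat_min)
  have fh: "f \<le> h" "f \<le> h'" by (auto simp: f_def le_fun_def)
  have hg: "h i < g i" if "i \<le> n" for i
    using less_progress[OF False that, of h] h(3) by (auto simp: le_fun_def intro: less_le_trans)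
  \<comment> \<open>The value at \<open>m\<close> after only \<beta> of the \<beta> + 1 increments;
    the last increment yields the strict inequality \<open>r < g m\<close>.\<close>
  define r where "r = f m + omega_pow (f (Suc m)) * \<beta>"
  \<comment> \<open>The added power makes \<open>y\<close> a legal entry below
    \<open>h (Suc m)\<close>. It keeps \<open>y\<close> under \<open>g m\<close>, a multiple of
    \<open>omega_pow (g (Suc m))\<close>, because \<open>h (Suc m) < g (Suc m)\<close>.\<close>
  define y where "y = max (h m) r + omega_pow (h (Suc m))"
  define k where "k = fill h m y"
  have fp: "progress m (\<beta> + 1) f = fill f m (r + omega_pow (f (Suc m)))"
    by (simp add: progress_def r_def eps0_distrib add.assoc)
  have "progress m (\<beta> + 1) f \<le> g" using progress_mono[OF fh(2) order_refl] h'(3) by (rule order_trans)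
  then have "r + omega_pow (f (Suc m)) \<le> g m" unfolding fp by (metis fill_at le_fun_def)
  then have "r < g m" using eps0_less_add[of "omega_pow (f (Suc m))" r] by simp
  then have y: "y < g m"
    unfolding y_def using hg[of m] hg[of "Suc m"] \<open>m < n\<close> ignatiev_dvd[OF g]
    by (intro add_omega_pow_less) auto
  have "h m \<le> y" unfolding y_def by (meson eps0_le_add1 max.cobounded1 order_trans)
  then have hk: "h \<le> k" by (simp add: k_def le_fill)
  have k: "ignatiev k"
    unfolding k_def using h(1) by (intro fill_ignatiev) (auto simp: ignatiev_def y_def ign_step_add_omega_pow)
  have "progress m (\<beta> + 1) f \<le> k"
    unfolding fp k_def y_def using fh(1)
    by (intro fill_mono eps0_add_mono) (auto simp: le_fun_def)
  then have "sat k (\<phi> \<^bold>\<and> dia m (\<beta> + 1) \<psi>)" using sat_mono[OF h(2) hk] f sat_dia[OF k] by auto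
  moreover have "progress n \<alpha> k \<le> g"
  proof -
    have above: "k i = h i" if "m < i" for i using that by (simp add: k_def fill_above)
    have "progress n \<alpha> h n = k n + omega_pow (k (Suc n)) * \<alpha>"
      using \<open>m < n\<close> by (simp add: progress_at above)
    then have "k n + omega_pow (k (Suc n)) * \<alpha> \<le> g n" using h(3) by (metis le_fun_def)
    moreover have "k i \<le> g i" if "n < i" for i
      using that \<open>m < n\<close> above le_progress[of h n \<alpha>] h(3) by (metis less_trans le_fun_def order_trans)
    moreover have "k i < g i" if "i < n" for i
    proof (cases "m < i")
      case False
      then show ?thesis unfolding k_def using y hg \<open>m < n\<close> by (intro fill_less g) auto
    qed (use above hg that in auto)
    ultimately show ?thesis using False unfolding progress_def by (auto intro!: fill_le g)
  qed
  ultimately show ?thesis using sat_dia[OF g] k by blast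
qed


section \<open>Sequences of monomial normal forms\<close>

text \<open>Exponent 0 is ruled out for singletons, so that \<open>[]\<close> is the only such list
  denoting \<open>Top\<close>.\<close>

fun mnf_list :: "(nat \<times> eps0) list \<Rightarrow> bool" where
  "mnf_list [] \<longleftrightarrow> True"
| "mnf_list [(n, \<alpha>)] \<longleftrightarrow> \<alpha> \<noteq> 0"
| "mnf_list ((n, \<alpha>) # (m, \<beta>) # xs) \<longleftrightarrow>
    n < m \<and> (\<exists>\<gamma>. \<alpha> = hexp (m - n) \<beta> * (2 + \<gamma>)) \<and> mnf_list ((m, \<beta>) # xs)"

text \<open>Gaps before a monomial are filled with the iterated hyper-exponentials that any Ignatiev
  sequence must reach there; past the last monomial nothing is demanded.\<close>

fun mnf_seq :: "(nat \<times> eps0) list \<Rightarrow> nat \<Rightarrow> eps0" where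
  "mnf_seq [] i = 0"
| "mnf_seq ((n, \<alpha>) # xs) i = (if i \<le> n then hexp (n - i) \<alpha> else mnf_seq xs i)"

lemma mnf_list_nonzero: "mnf_list xs \<Longrightarrow> (n, \<alpha>) \<in> set xs \<Longrightarrow> \<alpha> \<noteq> 0"
proof (induction xs arbitrary: n \<alpha> rule: mnf_list.induct)
  case (3 n' \<alpha>' m \<beta> xs)
  then have "\<beta> \<noteq> 0" by auto
  with 3 show ?case by (auto simp: eps0_two_add)
qed auto

lemma mnf_list_tail: "mnf_list (x # xs) \<Longrightarrow> mnf_list xs"
  by (cases x; cases xs) auto

lemma mnf_list_sorted: "mnf_list ((n, \<alpha>) # xs) \<Longrightarrow> (m, \<beta>) \<in> set xs \<Longrightarrow> n < m"
proof (induction xs arbitrary: n \<alpha>)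
  case (Cons x xs)
  obtain n' \<alpha>' where x: "x = (n', \<alpha>')" by force
  from Cons.prems(1) x have "n < n'" "mnf_list ((n', \<alpha>') # xs)" by auto
  with Cons.IH[of n' \<alpha>'] Cons.prems(2) x show ?case by auto
qed auto

lemma mnf_seq_below:
  assumes "mnf_list ((n, \<alpha>) # xs)" "i \<le> n"
  shows "mnf_seq xs i = hexp 1 (mnf_seq xs (Suc i))"
proof (cases xs)
  case Nil
  then show ?thesis by simp
next
  case (Cons p zs)
  then obtain m \<beta> where "xs = (m, \<beta>) # zs" by (cases p) auto
  then show ?thesis using assms by (simp add: hexp_diff_Suc)
qed

text \<open>The first fact makes the sequence Ignatiev at \<open>n\<close>. The second makes the
  monomial visible: the entry is not the value forced by its successor.\<close>

lemma mnf_head: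
  assumes "mnf_list ((n, \<alpha>) # xs)"
  shows "ign_step (mnf_seq xs (Suc n)) \<alpha>" "\<alpha> \<noteq> hexp 1 (mnf_seq xs (Suc n))"
proof -
  have nz: "\<alpha> \<noteq> 0" using mnf_list_nonzero[OF assms] by auto
  have "ign_step (mnf_seq xs (Suc n)) \<alpha> \<and> \<alpha> \<noteq> hexp 1 (mnf_seq xs (Suc n))"
  proof (cases xs)
    case Nil
    then show ?thesis using nz by (simp add: hexp_1)
  next
    case (Cons p zs)
    then obtain m \<beta> where xs: "xs = (m, \<beta>) # zs" by (cases p) auto
    with assms obtain \<gamma> where \<gamma>: "\<alpha> = hexp (m - n) \<beta> * (2 + \<gamma>)" and m: "n < m" by auto
    define c where "c = mnf_seq xs (Suc n)"
    have c: "c = hexp (m - Suc n) \<beta>" using m xs by (simp add: c_def)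
    have "\<beta> \<noteq> 0" using mnf_list_nonzero[OF assms] xs by auto
    then have "c \<noteq> 0" by (simp add: c)
    then have E: "hexp (m - n) \<beta> = omega_pow c" using m by (simp add: hexp_diff_Suc c hexp_1)
    \<comment> \<open>The factor 2 leaves a nonzero summand after one copy of
      \<open>omega_pow c\<close> is split off, hence \<alpha> exceeds the forced value.\<close>
    have "\<alpha> = omega_pow c + omega_pow c * (1 + \<gamma>)"
      unfolding \<gamma> E eps0_two_add by (simp add: eps0_distrib)
    then have "omega_pow c < \<alpha>" by (simp add: eps0_less_add)
    moreover have "omega_pow c dvd \<alpha>" by (simp add: \<gamma> E dvd_def) blast
    ultimately show ?thesis unfolding c_def[symmetric] using nz \<open>c \<noteq> 0\<close>
      by (auto simp: ign_step_def hexp_1)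
  qed
  then show "ign_step (mnf_seq xs (Suc n)) \<alpha>" "\<alpha> \<noteq> hexp 1 (mnf_seq xs (Suc n))" by auto
qed

lemma ign_step_hexp_1: "ign_step b (hexp 1 b)"
  using ign_step_add_omega_pow[of b 0] by (auto simp: hexp_1)

lemma mnf_seq_ignatiev: "mnf_list xs \<Longrightarrow> ignatiev (mnf_seq xs)"
proof (induction xs)
  case Nil
  then show ?case by (simp add: ignatiev_def)
next
  case (Cons p xs)
  obtain n \<alpha> where p: "p = (n, \<alpha>)" by force
  note IH = Cons.IH[OF mnf_list_tail[OF Cons.prems]]
  show ?case unfolding ignatiev_def
  proof
    fix i
    consider "i < n" | "i = n" | "n < i" by linarith
    then show "ign_step (mnf_seq (p # xs) (Suc i)) (mnf_seq (p # xs) i)"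
    proof cases
      case 1
      then show ?thesis using ign_step_hexp_1 by (simp add: p hexp_diff_Suc)
    next
      case 2
      then show ?thesis using mnf_head(1) Cons.prems by (simp add: p)
    next
      case 3
      then show ?thesis using IH by (simp add: p ignatiev_def)
    qed
  qed
qed

lemma mnf_seq_at: "mnf_list xs \<Longrightarrow> (n, \<alpha>) \<in> set xs \<Longrightarrow> mnf_seq xs n = \<alpha>"
proof (induction xs)
  case (Cons p xs)
  obtain m \<beta> where p: "p = (m, \<beta>)" by force
  show ?case
  proof (cases "(n, \<alpha>) = p")
    case False
    then have "(n, \<alpha>) \<in> set xs" using Cons.prems by auto
    moreover from this have "m < n" using mnf_list_sorted Cons.prems(1) p by blast
    ultimately show ?thesis using Cons.IH mnf_list_tail[OF Cons.prems(1)] by (simp add: p)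
  qed (simp add: p)
qed simp

section \<open>Normal forms and their least sequences\<close>

lemma mnf_seq_least:
  assumes "ignatiev g"
  shows "sat g (mconj xs) \<Longrightarrow> mnf_seq xs \<le> g"
  unfolding sat_mconj[OF assms]
proof (induction xs)
  case (Cons p xs)
  obtain n \<alpha> where p: "p = (n, \<alpha>)" by force
  with Cons have n: "\<alpha> \<le> g n" and IH: "mnf_seq xs \<le> g" by auto
  have "hexp (n - i) \<alpha> \<le> g i" if "i \<le> n" for i
    using that n by (intro ignatiev_hexp_le assms) auto
  with IH show ?case by (auto simp: p le_fun_def)
qed (simp add: le_fun_def)

lemma sat_mnf_seq: "mnf_list xs \<Longrightarrow> sat (mnf_seq xs) (mconj xs)"
  by (auto simp: sat_mconj[OF mnf_seq_ignatiev] mnf_seq_at)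

text \<open>The head sits at the least \<open>i\<close> where the sequence differs from
  \<open>hexp 1\<close> of its next entry. Once the heads agree, the tail sequences agree above
  \<open>n\<close>, and \<open>mnf_seq_below\<close> determines them from there downward.\<close>

lemma mnf_seq_inj:
  "mnf_list xs \<Longrightarrow> mnf_list ys \<Longrightarrow> mnf_seq xs = mnf_seq ys \<Longrightarrow> xs = ys"
proof (induction xs arbitrary: ys)
  case Nil
  show ?case
  proof (cases ys)
    case (Cons p zs)
    obtain n \<alpha> where p: "p = (n, \<alpha>)" by force
    have "mnf_seq ys n = \<alpha>" "\<alpha> \<noteq> 0"
      using mnf_list_nonzero[OF Nil(2)] by (auto simp: Cons p)
    with Nil(3) show ?thesis by (metis mnf_seq.simps(1))
  qed simp
next
  case (Cons p xs)
  obtain n \<alpha> where p: "p = (n, \<alpha>)" by force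
  have eq: "mnf_seq ys i = mnf_seq ((n, \<alpha>) # xs) i" for i by (simp only: Cons.prems(3) flip: p)
  have nz: "\<alpha> \<noteq> 0" using mnf_list_nonzero[OF Cons.prems(1)] p by auto
  obtain m \<beta> zs where ys: "ys = (m, \<beta>) # zs"
  proof (cases ys)
    case Nil
    with eq[of n] nz show ?thesis by simp
  next
    case (Cons q zs)
    then show ?thesis using that by (cases q) auto
  qed
  note good = Cons.prems(1)[unfolded p] Cons.prems(2)[unfolded ys]
  \<comment> \<open>Otherwise \<open>n\<close> lies in the gap before the head of \<open>ys\<close>,
    where the entry is the forced one, contradicting \<open>mnf_head\<close>.\<close>
  have "\<not> n < m"
    using eq[of n] eq[of "Suc n"] mnf_head(2)[OF good(1)]
    by (auto simp: ys hexp_diff_Suc)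
  moreover have "\<not> m < n"
    using eq[of m] eq[of "Suc m"] mnf_head(2)[OF good(2)]
    by (auto simp: ys hexp_diff_Suc)
  ultimately have m: "m = n" by simp
  have \<beta>: "\<beta> = \<alpha>" using eq[of n] by (simp add: ys m)
  have above: "mnf_seq xs i = mnf_seq zs i" if "n < i" for i
    using eq[of i] that by (simp add: ys m)
  \<comment> \<open>Downward induction from \<open>Suc n\<close>, with \<open>j\<close> the
    distance; truncated subtraction makes larger \<open>j\<close> harmless.\<close>
  have below: "mnf_seq xs (Suc n - j) = mnf_seq zs (Suc n - j)" for j
  proof (induction j)
    case (Suc j)
    show ?case
    proof (cases "j \<le> n")
      case True
      then have "Suc (n - j) = Suc n - j" by simp
      with Suc show ?thesis
        using mnf_seq_below[OF good(1), of "n - j"] mnf_seq_below[OF good(2), of "n - j"]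
        by (simp add: m)
    qed (use Suc in auto)
  qed (simp add: above)
  have "mnf_seq xs i = mnf_seq zs i" for i
    using above[of i] below[of "Suc n - i"] by (cases "n < i") auto
  then have "xs = zs"
    using good by (intro Cons.IH) (auto dest: mnf_list_tail simp: m \<beta>)
  then show ?case by (simp add: p ys m \<beta>)
qed

text \<open>Both \<open>[]\<close> and \<open>[(n, 0)]\<close> denote \<open>Top\<close>, hence the
  conditions on \<open>ys\<close>; its \<open>Mod\<close> conjuncts then force the exponents in
  \<open>xs\<close> to be nonzero as well.\<close>

lemma mconj_inj:
  "mconj xs = mconj ys \<Longrightarrow> ys \<noteq> [] \<Longrightarrow> \<forall>(n, \<alpha>) \<in> set ys. \<alpha> \<noteq> 0 \<Longrightarrow> xs = ys"
proof (induction xs arbitrary: ys rule: mconj.induct)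
  case 1
  then show ?case by (cases ys rule: mconj.cases) (auto simp: dia_def split: if_splits)
next
  case (2 n \<alpha>)
  then show ?case by (cases ys rule: mconj.cases) (auto simp: dia_def split: if_splits)
next
  case (3 n \<alpha> x xs)
  obtain m \<beta> y zs where ys: "ys = (m, \<beta>) # y # zs"
    using 3(2-) by (cases ys rule: mconj.cases) (auto simp: dia_def split: if_splits)
  with 3(2-) have "x # xs = y # zs" by (intro 3(1)) auto
  with ys 3(2-) show ?case by (auto simp: dia_def split: if_splits)
qed

lemma MNF_mnf_list: "\<psi> \<in> MNF \<Longrightarrow> \<exists>xs. mnf_list xs \<and> \<psi> = mconj xs"
proof (induction rule: MNF.induct)
  case Top
  show ?case by (intro exI[of _ "[]"]) simp
next
  case (monomial n \<alpha>)
  show ?case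
  proof (cases "\<alpha> = 0")
    case True
    then show ?thesis by (intro exI[of _ "[]"]) (simp add: dia_def)
  next
    case False
    then show ?thesis by (intro exI[of _ "[(n, \<alpha>)]"]) simp
  qed
next
  case (step n0 \<alpha>0 xs n \<alpha> \<beta>)
  then obtain ys where ys: "mnf_list ys" "mconj ((n0, \<alpha>0) # xs) = mconj ys" by blast
  have "mconj ((n0, \<alpha>0) # xs) \<noteq> Top" using step(2) by (cases xs) (auto simp: dia_def)
  then have "ys \<noteq> []" using ys by auto
  then have "(n0, \<alpha>0) # xs = ys" using ys mnf_list_nonzero by (intro mconj_inj) auto
  then show ?case using ys step by (intro exI[of _ "(n, \<alpha>) # (n0, \<alpha>0) # xs"]) auto
qed

text \<open>The Schmerl axioms name a particular list, so existence of some list for the formula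
  does not suffice; \<open>mconj_inj\<close> identifies the two.\<close>

lemma mnf_list_of_MNF:
  assumes "mconj ((n, \<alpha>) # xs) \<in> MNF" "0 < \<alpha>"
  shows "mnf_list ((n, \<alpha>) # xs)"
proof -
  obtain ys where ys: "mnf_list ys" "mconj ((n, \<alpha>) # xs) = mconj ys"
    using MNF_mnf_list assms by blast
  have "mconj ((n, \<alpha>) # xs) \<noteq> Top" using assms(2) by (cases xs) (auto simp: dia_def)
  then have "ys \<noteq> []" using ys by auto
  then have "(n, \<alpha>) # xs = ys" using ys mnf_list_nonzero by (intro mconj_inj) auto
  then show ?thesis using ys by simp
qed


section \<open>Soundness\<close>

text \<open>By monotonicity the least sequence \<open>v\<close> of the conjunction can replace any
  witness, and since \<open>v n\<close> equals \<open>omega_pow (v (Suc n))\<close>, raising it by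
  \<alpha> gives exactly \<open>E * (1 + \<alpha>)\<close> at \<open>n\<close>.\<close>

lemma sat_schmerl:
  assumes g: "ignatiev g" and X: "mnf_list ((n\<^sub>0, \<alpha>\<^sub>0) # xs)" and n: "n < n\<^sub>0"
  shows "sat g (dia n \<alpha> (mconj ((n\<^sub>0, \<alpha>\<^sub>0) # xs))) \<longleftrightarrow>
    sat g (mconj ((n, hexp (n\<^sub>0 - n) \<alpha>\<^sub>0 * (1 + \<alpha>)) # (n\<^sub>0, \<alpha>\<^sub>0) # xs))"
proof -
  let ?X = "mconj ((n\<^sub>0, \<alpha>\<^sub>0) # xs)"
  define E where "E = hexp (n\<^sub>0 - n) \<alpha>\<^sub>0"
  define v where "v = mnf_seq ((n\<^sub>0, \<alpha>\<^sub>0) # xs)"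
  have v: "ignatiev v" "sat v ?X" using mnf_seq_ignatiev[OF X] sat_mnf_seq[OF X] by (auto simp: v_def)
  have "\<alpha>\<^sub>0 \<noteq> 0" using mnf_list_nonzero[OF X] by auto
  have vE: "v n = E" using n by (simp add: v_def E_def)
  have v_Suc: "v i = omega_pow (v (Suc i))" if "i < n\<^sub>0" for i
    using that \<open>\<alpha>\<^sub>0 \<noteq> 0\<close> by (simp add: v_def hexp_diff_Suc hexp_1)
  have rhs: "sat g (mconj ((n, E * (1 + \<alpha>)) # (n\<^sub>0, \<alpha>\<^sub>0) # xs)) \<longleftrightarrow> E * (1 + \<alpha>) \<le> g n \<and> sat g ?X"
    by (simp add: sat_dia_Top[OF g])
  have least: "progress n \<alpha> v n = E * (1 + \<alpha>)"
    using v_Suc[OF n] by (simp add: progress_at vE eps0_distrib)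
  have "sat g (dia n \<alpha> ?X) \<longleftrightarrow> E * (1 + \<alpha>) \<le> g n \<and> sat g ?X"
  proof
    assume "sat g (dia n \<alpha> ?X)"
    then obtain h where h: "ignatiev h" "sat h ?X" "progress n \<alpha> h \<le> g" using sat_dia[OF g] by blast
    have "v \<le> h" unfolding v_def using h by (intro mnf_seq_least)
    then have "progress n \<alpha> v \<le> g" using h(3) progress_mono order_trans by blast
    then have "E * (1 + \<alpha>) \<le> g n" using least by (metis le_fun_def)
    moreover have "h \<le> g" using h(3) le_progress order_trans by blast
    ultimately show "E * (1 + \<alpha>) \<le> g n \<and> sat g ?X" using sat_mono[OF h(2)] by blast
  next
    assume asm: "E * (1 + \<alpha>) \<le> g n \<and> sat g ?X"
    have vg: "v \<le> g" unfolding v_def using asm g by (intro mnf_seq_least) auto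
    show "sat g (dia n \<alpha> ?X)"
    proof (cases "\<alpha> = 0")
      case True
      then show ?thesis using asm by (simp add: dia_def)
    next
      case False
      have vn: "v n < g n" using less_progress[OF False order_refl, of v n] asm least by auto
      \<comment> \<open>Below \<open>n\<close> the entries of \<open>v\<close> are bare powers of
        omega, so the strict inequality at \<open>n\<close> descends by strict monotonicity of
        exponentiation.\<close>
      have "v (n - j) < g (n - j)" for j
      proof (induction j)
        case (Suc j)
        show ?case
        proof (cases "j < n")
          case True
          then have s: "Suc (n - Suc j) = n - j" by simp
          have "v (n - Suc j) = omega_pow (v (n - j))" using v_Suc[of "n - Suc j"] n s by simp
          also have "\<dots> < omega_pow (g (n - j))" using Suc by simp
          also have "\<dots> = hexp 1 (g (n - j))" using Suc by (auto simp: hexp_1)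
          also have "\<dots> \<le> g (n - Suc j)"
            using g s unfolding ignatiev_def by (metis ign_step_hexp_le)
          finally show ?thesis .
        qed (use Suc in simp)
      qed (use vn in simp)
      then have "v i < g i" if "i < n" for i using that by (metis diff_diff_cancel less_imp_le)
      then have "progress n \<alpha> v \<le> g"
        using False vg asm least unfolding progress_def
        by (auto simp: le_fun_def[of v] intro!: fill_le g)
      then show ?thesis using sat_dia[OF g] v by blast
    qed
  qed
  with rhs show ?thesis by (simp add: E_def)
qed

theorem tsc_sound: "\<phi> \<turnstile> \<psi> \<Longrightarrow> ignatiev g \<Longrightarrow> sat g \<phi> \<Longrightarrow> sat g \<psi>"
proof (induction arbitrary: g rule: tsc.induct)
  case (mono \<phi> \<beta> \<alpha> n)
  then show ?case by (meson sat_dia progress_mono order_refl order_trans)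
next
  case (add1 \<phi> n \<alpha> \<beta>)
  then obtain h where h: "ignatiev h" "sat h \<phi>" "progress n (\<alpha> + \<beta>) h \<le> g" using sat_dia by blast
  \<comment> \<open>The sequence raised by \<alpha> alone is the witness for the outer
    modality.\<close>
  have i: "ignatiev (progress n \<alpha> h)" using h by (simp add: progress_ignatiev)
  with h have "sat (progress n \<alpha> h) (dia n \<alpha> \<phi>)" using sat_dia[OF i] by blast
  with i h show ?case using sat_dia[OF add1(2)] by (metis progress_add)
next
  case (add2 \<phi> n \<beta> \<alpha>)
  then obtain k where k: "ignatiev k" "sat k (dia n \<alpha> \<phi>)" "progress n \<beta> k \<le> g" using sat_dia by blast
  then obtain h where h: "ignatiev h" "sat h \<phi>" "progress n \<alpha> h \<le> k" using sat_dia by blast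
  have "progress n (\<alpha> + \<beta>) h \<le> g"
    using progress_mono[OF h(3) order_refl, of n \<beta>] k(3) by (simp add: progress_add)
  with h show ?case using sat_dia[OF add2(2)] by blast
next
  case (reduct \<phi> m n \<alpha>)
  then show ?case by (meson sat_dia progress_hexp_le order_trans)
next
  case (schmerl1 n0 \<alpha>0 xs n \<alpha>)
  then show ?case using sat_schmerl mnf_list_of_MNF by blast
next
  case (schmerl2 n0 \<alpha>0 xs n \<alpha>)
  then show ?case using sat_schmerl mnf_list_of_MNF by blast
next
  case (nec \<phi> \<psi> n \<alpha>)
  then show ?case by (meson sat_dia)
next
  case (dist \<phi> \<psi> m n \<alpha> \<beta>)
  then show ?case by (auto intro: sat_dist)
qed auto

theorem theorem6p18:
  fixes \<psi>\<^sub>1 \<psi>\<^sub>2 :: form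
  assumes "\<psi>\<^sub>1 \<in> MNF" and "\<psi>\<^sub>2 \<in> MNF" and "\<psi>\<^sub>1 \<equiv>\<^sub>T \<psi>\<^sub>2"
  shows "\<psi>\<^sub>1 = \<psi>\<^sub>2"
proof -
  obtain xs ys where xs: "mnf_list xs" "\<psi>\<^sub>1 = mconj xs" and ys: "mnf_list ys" "\<psi>\<^sub>2 = mconj ys"
    using MNF_mnf_list assms by meson
  \<comment> \<open>Soundness is applied at the least sequence of the premise, which must then lie
    above that of the conclusion; both directions together give equality.\<close>
  have le: "mnf_seq vs \<le> mnf_seq us" if "mnf_list us" "mconj us \<turnstile> mconj vs" for us vs
    using that by (intro mnf_seq_least tsc_sound[OF that(2)] mnf_seq_ignatiev sat_mnf_seq)
  have "mnf_seq xs = mnf_seq ys"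
    using le[of xs ys] le[of ys xs] assms(3) xs ys by (auto simp: tsc_equiv_def intro: antisym)
  then show ?thesis using mnf_seq_inj xs ys by blast
qed

end
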